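(* Let $\varepsilon,\delta\in(0,1)$, let $n\in\mathbb{N}$, let $\mathcal{D}$ be a distribution on $\mathcal{G}_n$ with full support, and let $S\subseteq\mathcal{G}_n$ be a (nonempty) finite set of graphs. There is a number of samples $$\ell=O\!\left(\frac{\log(|S|/\delta)}{\varepsilon^2}\right)$$ such that if $\mathcal{F}=(F_1,\dots,F_\ell)\sim\mathcal{D}^\ell$ is sampled i.i.d., then with probability at least $1-\delta$ $$\max_{G,G'\in S}\left|\tilde{k}_{\mathcal{F}}(G,G')-k_{\mathcal{D}}(G,G')\right|<\varepsilon .$$ Here the $O$-notation means: there is an absolute constant $C>0$ such that, whenever $|S|/\delta\ge 2$, a positive integer $\ell\le C\log(|S|/\delta)/\varepsilon^2$ with this property exists.
   Context: Graphs are finite, undirected and simple, with at least one vertex; $v(G)$ is the number of vertices of $G$. $\mathcal{G}_n$ is the set of all graphs with at most $n$ vertices, considered up to isomorphism (one representative per isomorphism class), so that $\mathcal{G}_n$ is finite. $\mathcal{D}$ has full support if every element of $\mathcal{G}_n$ has nonzero probability. $\hom(F,G)$ is the number of graph homomorphisms (edge-preserving maps $V(F)\to V(G)$), and $t(F,G)=\hom(F,G)/v(G)^{v(F)}$ is the homomorphism density. For $\mathcal{F}=(F_1,\dots,F_\ell)$ define $\psi_{\mathcal{F}}(G)=\frac{1}{\sqrt{\ell}}(t(F_1,G),\dots,t(F_\ell,G))\in\mathbb{R}^\ell$ and $$\tilde{k}_{\mathcal{F}}(G,G')=\langle\psi_{\mathcal{F}}(G),\psi_{\mathcal{F}}(G')\rangle=\frac1\ell\sum_{i=1}^{\ell}t(F_i,G)\,t(F_i,G').$$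 Define $$k_{\mathcal{D}}(G,G')=\mathbb{E}_{F\sim\mathcal{D}}[t(F,G)\,t(F,G')]=\sum_{F\in\mathcal{G}_n}\Pr_{X\sim\mathcal{D}}(X=F)\,t(F,G)\,t(F,G').$$ *)

theory Defs
  imports
    "HOL-Probability.Probability"
    "Graph_Theory.Pair_Digraph"
    "Graph_Theory.Digraph_Isomorphism"
begin

text \<open>
  A finite simple undirected graph is a \<^locale>\<open>pair_graph\<close>: a finite vertex set together with a
  symmetric irreflexive set of pairs, each undirected edge being present in both orientations.
\<close>

definition simple_graph :: "'a pair_pre_digraph \<Rightarrow> bool" where
  "simple_graph G \<longleftrightarrow> pair_graph G \<and> pverts G \<noteq> {}"

definition graph_iso :: "'a pair_pre_digraph \<Rightarrow> 'b pair_pre_digraph \<Rightarrow> bool" where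
  "graph_iso G H \<longleftrightarrow> digraph_iso (with_proj G) (with_proj H)"

text \<open>
  \<open>iso_representatives n \<G>\<close>: the set \<open>\<G>\<close> contains exactly one graph from each isomorphism class
  of graphs with at most \<open>n\<close> vertices. Vertices are natural numbers, so every finite graph
  has an isomorphic copy.
\<close>

definition iso_representatives :: "nat \<Rightarrow> nat pair_pre_digraph set \<Rightarrow> bool" where
  "iso_representatives n \<G> \<longleftrightarrow>
     (\<forall>G\<in>\<G>. simple_graph G \<and> card (pverts G) \<le> n) \<and>
     (\<forall>H::nat pair_pre_digraph. simple_graph H \<and> card (pverts H) \<le> n \<longrightarrow> (\<exists>!G. G \<in> \<G> \<and> graph_iso H G))"

definition graph_homs :: "'a pair_pre_digraph \<Rightarrow> 'b pair_pre_digraph \<Rightarrow> ('a \<Rightarrow> 'b) set" where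
  "graph_homs F G =
     {f \<in> pverts F \<rightarrow>\<^sub>E pverts G. \<forall>(u, v)\<in>parcs F. (f u, f v) \<in> parcs G}"

definition hom_count :: "'a pair_pre_digraph \<Rightarrow> 'b pair_pre_digraph \<Rightarrow> nat" where
  "hom_count F G = card (graph_homs F G)"

definition hom_density :: "'a pair_pre_digraph \<Rightarrow> 'b pair_pre_digraph \<Rightarrow> real" where
  "hom_density F G = real (hom_count F G) / real (card (pverts G)) ^ card (pverts F)"

text \<open>
  A tuple \<open>(F\<^sub>1, \<dots>, F\<^sub>l)\<close> is a function on the index set \<open>{..<l}\<close>, and so is a vector of dimension \<open>l\<close>.
\<close>

definition hom_embedding ::
  "nat \<Rightarrow> (nat \<Rightarrow> 'a pair_pre_digraph) \<Rightarrow> 'b pair_pre_digraph \<Rightarrow> nat \<Rightarrow> real" where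
  "hom_embedding l F G i = 1 / sqrt (real l) * hom_density (F i) G"

definition sampled_kernel ::
  "nat \<Rightarrow> (nat \<Rightarrow> 'a pair_pre_digraph) \<Rightarrow> 'b pair_pre_digraph \<Rightarrow> 'b pair_pre_digraph \<Rightarrow> real" where
  "sampled_kernel l F G G' = (\<Sum>i<l. hom_embedding l F G i * hom_embedding l F G' i)"

definition expected_kernel ::
  "'a pair_pre_digraph pmf \<Rightarrow> 'b pair_pre_digraph \<Rightarrow> 'b pair_pre_digraph \<Rightarrow> real" where
  "expected_kernel D G G' = measure_pmf.expectation D (\<lambda>F. hom_density F G * hom_density F G')"

definition iid_tuple_pmf :: "nat \<Rightarrow> 'a pmf \<Rightarrow> (nat \<Rightarrow> 'a) pmf" where
  "iid_tuple_pmf l D = Pi_pmf {..<l} undefined (\<lambda>_. D)"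

lemma sampled_kernel_eq:
  "sampled_kernel l F G G' = 1 / real l * (\<Sum>i<l. hom_density (F i) G * hom_density (F i) G')"
  by (cases "l = 0")
    (auto simp: sampled_kernel_def hom_embedding_def sum_divide_distrib)

lemma expected_kernel_eq_sum:
  assumes "finite (set_pmf D)"
  shows "expected_kernel D G G' =
    (\<Sum>F\<in>set_pmf D. pmf D F * (hom_density F G * hom_density F G'))"
  unfolding expected_kernel_def
  by (subst integral_measure_pmf[OF assms]) (auto simp: mult_ac)

lemma graph_iso_altdef:
  assumes "pair_graph G"
  shows "graph_iso G H \<longleftrightarrow>
    (\<exists>f. bij_betw f (pverts G) (pverts H) \<and> parcs H = map_prod f f ` parcs G)"
proof
  assume "graph_iso G H"
  then obtain h where h: "pre_digraph.digraph_isomorphism (with_proj G) h"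
      and eq: "with_proj H = app_iso h (with_proj G)"
    by (auto simp: graph_iso_def digraph_iso_def)
  have verts: "pverts H = iso_verts h ` pverts G" and arcs: "parcs H = iso_arcs h ` parcs G"
    and t: "iso_tail h = fst" and hd: "iso_head h = snd"
    using eq by (auto simp: with_proj_def app_iso_def)
  have "iso_arcs h a = map_prod (iso_verts h) (iso_verts h) a" if "a \<in> parcs G" for a
    using h that t hd
    by (cases a; cases "iso_arcs h a") (force simp: pre_digraph.digraph_isomorphism_def)
  then have "parcs H = map_prod (iso_verts h) (iso_verts h) ` parcs G"
    using arcs by auto
  moreover have "bij_betw (iso_verts h) (pverts G) (pverts H)"
    using h verts by (auto simp: pre_digraph.digraph_isomorphism_def bij_betw_def)
  ultimately show "\<exists>f. bij_betw f (pverts G) (pverts H) \<and> parcs H = map_prod f f ` parcs G"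
    by blast
next
  assume "\<exists>f. bij_betw f (pverts G) (pverts H) \<and> parcs H = map_prod f f ` parcs G"
  then obtain f where f: "bij_betw f (pverts G) (pverts H)" "parcs H = map_prod f f ` parcs G"
    by blast
  interpret pair_graph G by fact
  define h where "h = \<lparr>iso_verts = f, iso_arcs = map_prod f f, iso_head = snd, iso_tail = fst\<rparr>"
  have "inj_on (map_prod f f) (parcs G)"
    using f(1) wellformed' by (auto simp: bij_betw_def inj_on_def)
  then have "pre_digraph.digraph_isomorphism (with_proj G) h"
    using f(1) wf_digraph by (auto simp: pre_digraph.digraph_isomorphism_def h_def bij_betw_def)
  moreover have "with_proj H = app_iso h (with_proj G)"
    using f by (auto simp: with_proj_def app_iso_def h_def bij_betw_def)
  ultimately show "graph_iso G H"
    by (auto simp: graph_iso_def digraph_iso_def)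
qed

lemma graph_iso_refl: "pair_graph G \<Longrightarrow> graph_iso G G"
  by (auto simp: graph_iso_altdef intro!: exI[of _ id] simp: map_prod.id)

lemma graph_iso_sym:
  assumes "pair_graph G" "pair_graph H" "graph_iso G H"
  shows "graph_iso H G"
proof -
  interpret pair_graph G by fact
  obtain f where f: "bij_betw f (pverts G) (pverts H)" "parcs H = map_prod f f ` parcs G"
    using assms by (auto simp: graph_iso_altdef)
  define g where "g = inv_into (pverts G) f"
  have gf: "g (f x) = x" if "x \<in> pverts G" for x
    using f(1) that by (auto simp: g_def bij_betw_def)
  have "map_prod g g (map_prod f f a) = a" if "a \<in> parcs G" for a
    using that gf wellformed' by (cases a) auto
  then have "parcs G = map_prod g g ` parcs H"
    unfolding f(2) image_image by force
  moreover have "bij_betw g (pverts H) (pverts G)"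
    using f(1) by (auto simp: g_def intro: bij_betw_inv_into)
  ultimately show ?thesis
    using assms(2) by (auto simp: graph_iso_altdef)
qed

lemma graph_iso_trans:
  assumes "pair_graph G" "pair_graph H" "graph_iso G H" "graph_iso H K"
  shows "graph_iso G K"
proof -
  obtain f g where f: "bij_betw f (pverts G) (pverts H)" "parcs H = map_prod f f ` parcs G"
    and g: "bij_betw g (pverts H) (pverts K)" "parcs K = map_prod g g ` parcs H"
    using assms by (auto simp: graph_iso_altdef)
  have "bij_betw (g \<circ> f) (pverts G) (pverts K)"
    using f g by (auto intro: bij_betw_trans)
  moreover have "parcs K = map_prod (g \<circ> f) (g \<circ> f) ` parcs G"
    by (simp add: f g image_image map_prod_def case_prod_unfold)
  ultimately show ?thesis
    using assms(1) by (auto simp: graph_iso_altdef)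
qed

lemma iso_representatives_exists: "\<exists>\<G>. iso_representatives n \<G>"
proof -
  define A where "A = {G::nat pair_pre_digraph. simple_graph G \<and> card (pverts G) \<le> n}"
  define r where "r = (\<lambda>H::nat pair_pre_digraph. SOME G. G \<in> A \<and> graph_iso H G)"
  have r: "r H \<in> A \<and> graph_iso H (r H)" if "H \<in> A" for H
    unfolding r_def
    by (rule someI[of _ H]) (use that in \<open>auto simp: A_def simple_graph_def intro: graph_iso_refl\<close>)
  have pg: "pair_graph G" if "G \<in> A" for G
    using that by (auto simp: A_def simple_graph_def)
  have eq: "r H = r K" if "H \<in> A" "K \<in> A" "graph_iso H K" for H K
  proof -
    have "graph_iso K H"
      by (rule graph_iso_sym) (use that pg in auto)
    then have "graph_iso H G \<longleftrightarrow> graph_iso K G" for G :: "nat pair_pre_digraph"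
      using graph_iso_trans[of H K G] graph_iso_trans[of K H G] that pg by blast
    then show ?thesis
      by (simp add: r_def)
  qed
  have "\<exists>!G. G \<in> r ` A \<and> graph_iso H G" if "H \<in> A" for H
  proof (rule ex1I[of _ "r H"])
    show "r H \<in> r ` A \<and> graph_iso H (r H)" using r that by auto
  next
    fix G assume G: "G \<in> r ` A \<and> graph_iso H G"
    then obtain K where K: "K \<in> A" "G = r K" by auto
    have "r H = r G" using eq[of H G] that r[OF K(1)] K(2) G by blast
    moreover have "r K = r G" using eq[of K G] r[OF K(1)] K by blast
    ultimately show "G = r H" using K(2) by metis
  qed
  then have "iso_representatives n (r ` A)"
    unfolding iso_representatives_def using r A_def by (metis (no_types, lifting) imageE mem_Collect_eq)
  then show ?thesis by blast
qed

lemma iso_representatives_finite: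
  assumes "iso_representatives n \<G>"
  shows "finite \<G>"
proof -
  have "\<exists>K::nat pair_pre_digraph. pair_graph K \<and> pverts K \<subseteq> {..<n} \<and> graph_iso G K" if "G \<in> \<G>" for G
  proof -
    have G: "pair_graph G" "card (pverts G) \<le> n"
      using assms that by (auto simp: iso_representatives_def simple_graph_def)
    interpret pair_graph G by fact
    obtain f where f: "bij_betw f (pverts G) {..<card (pverts G)}"
      using ex_bij_betw_finite_nat[OF pair_finite_verts] by (auto simp: atLeast0LessThan)
    define K where "K = \<lparr>pverts = {..<card (pverts G)}, parcs = map_prod f f ` parcs G\<rparr>"
    have "graph_iso G K"
      using f G(1) by (auto simp: graph_iso_altdef K_def)
    moreover have "pair_graph K"
    proof
      show "e \<in> parcs K \<Longrightarrow> fst e \<in> pverts K" "e \<in> parcs K \<Longrightarrow> snd e \<in> pverts K" for e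
        using f wellformed' by (auto simp: K_def bij_betw_def)
      show "finite (pverts K)" "finite (parcs K)"
        using pair_finite_arcs by (auto simp: K_def)
      show "e \<in> parcs K \<Longrightarrow> fst e \<noteq> snd e" for e
      proof -
        assume "e \<in> parcs K"
        then obtain u v where uv: "(u, v) \<in> parcs G" "e = (f u, f v)" by (auto simp: K_def)
        then have "f u = f v \<longleftrightarrow> u = v"
          using inj_on_eq_iff[OF bij_betw_imp_inj_on[OF f]] wellformed' by blast
        then show "fst e \<noteq> snd e"
          using uv no_loops' by auto
      qed
      show "symmetric (with_proj K)"
        unfolding symmetric_def
      proof (rule symI)
        fix a b assume "(a, b) \<in> arcs_ends (with_proj K)"
        then obtain u v where "(u, v) \<in> parcs G" "a = f u" "b = f v" by (auto simp: K_def)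
        then show "(b, a) \<in> arcs_ends (with_proj K)"
          using arcs_symmetric[of u v] by (auto simp: K_def)
      qed
    qed
    ultimately show ?thesis
      using G by (intro exI[of _ K]) (auto simp: K_def)
  qed
  then obtain c :: "nat pair_pre_digraph \<Rightarrow> nat pair_pre_digraph"
    where c: "\<And>G. G \<in> \<G> \<Longrightarrow> pair_graph (c G) \<and> pverts (c G) \<subseteq> {..<n} \<and> graph_iso G (c G)"
    by metis
  have pg: "pair_graph G" if "G \<in> \<G>" for G
    using assms that by (auto simp: iso_representatives_def simple_graph_def)
  have "inj_on c \<G>"
  proof (rule inj_onI)
    fix G H assume GH: "G \<in> \<G>" "H \<in> \<G>" "c G = c H"
    have "graph_iso (c G) H"
      unfolding GH(3) by (rule graph_iso_sym) (use GH c pg in auto)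
    then have "graph_iso G H"
      using graph_iso_trans[of G "c G" H] GH(1) c[of G] pg[of G] by blast
    moreover have "graph_iso G G"
      using GH pg graph_iso_refl by auto
    ultimately show "G = H"
      using assms GH unfolding iso_representatives_def by metis
  qed
  moreover have "c ` \<G> \<subseteq>
    (\<lambda>(V, E). \<lparr>pverts = V, parcs = E\<rparr>) ` (Pow {..<n} \<times> Pow ({..<n} \<times> {..<n}))"
  proof
    fix K assume "K \<in> c ` \<G>"
    then have K: "pair_graph K" "pverts K \<subseteq> {..<n}" using c by auto
    interpret pair_graph K by fact
    have "parcs K \<subseteq> {..<n} \<times> {..<n}"
      using K(2) wellformed' by (auto; blast)
    with K(2) show "K \<in> (\<lambda>(V, E). \<lparr>pverts = V, parcs = E\<rparr>) ` (Pow {..<n} \<times> Pow ({..<n} \<times> {..<n}))"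
      by (intro image_eqI[of _ _ "(pverts K, parcs K)"]) auto
  qed
  then have "finite (c ` \<G>)"
    by (rule finite_subset) auto
  ultimately show ?thesis
    by (rule finite_imageD[rotated])
qed

end

theory Submission
  imports Defs
begin

text \<open>
  Homomorphism densities lie in \<open>[0, 1]\<close>, so for each of the \<open>|S|\<^sup>2\<close> pairs \<open>(G, G')\<close> Hoeffding's
  inequality bounds the probability of a deviation of at least \<open>\<epsilon>\<close> by \<open>2 exp (-2 l \<epsilon>\<^sup>2)\<close>. With
  \<open>x = |S|/\<delta>\<close> and \<open>l \<ge> 3 ln x / (2 \<epsilon>\<^sup>2)\<close> this is at most \<open>2/x\<^sup>3\<close>, and the union bound gives the total
  failure probability \<open>2 |S|\<^sup>2/x\<^sup>3 = 2 \<delta>\<^sup>2/x \<le> \<delta>\<close>.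
\<close>

lemma hom_density_nonneg: "hom_density F G \<ge> 0"
  by (simp add: hom_density_def)

text \<open>Homomorphisms are particular maps between the vertex sets, and the denominator counts
  all such maps.\<close>

lemma hom_density_le_1:
  assumes "finite (pverts F)" "finite (pverts G)"
  shows "hom_density F G \<le> 1"
proof -
  have "hom_count F G \<le> card (pverts F \<rightarrow>\<^sub>E pverts G)"
    unfolding hom_count_def graph_homs_def using assms by (intro card_mono finite_PiE) auto
  also have "\<dots> = card (pverts G) ^ card (pverts F)"
    using assms by (simp add: card_PiE)
  finally have "real (hom_count F G) \<le> real (card (pverts G)) ^ card (pverts F)"
    by (metis of_nat_le_iff of_nat_power)
  then show ?thesis
    \<comment> \<open>An empty \<open>G\<close> is allowed, so the denominator may be 0; the
      quotient is then 0 by convention. Only a negative denominator has to be excluded.\<close>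
    using zero_le_power[of "real (card (pverts G))" "card (pverts F)"]
    unfolding hom_density_def divide_le_eq_1 by linarith
qed

text \<open>Each coordinate of the product has marginal \<open>D\<close>. The right-hand side does
  not mention \<open>i\<close>, which is how the variables \<open>h (F i)\<close> are seen to be
  identically distributed.\<close>

lemma map_pmf_iid_tuple_component:
  assumes "i < l"
  shows "map_pmf (\<lambda>F. h (F i)) (iid_tuple_pmf l D) = map_pmf h D"
proof -
  have "map_pmf (\<lambda>F. h (F i)) (iid_tuple_pmf l D) = map_pmf h (map_pmf (\<lambda>F. F i) (iid_tuple_pmf l D))"
    by (simp add: pmf.map_comp o_def)
  also have "map_pmf (\<lambda>F. F i) (iid_tuple_pmf l D) = D"
    using assms by (simp add: iid_tuple_pmf_def Pi_pmf_component)
  finally show ?thesis .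
qed

lemma iid_tuple_Hoeffding:
  fixes h :: "'a \<Rightarrow> real"
  assumes l: "l > 0" and \<epsilon>: "\<epsilon> \<ge> 0" and h: "\<And>x. x \<in> set_pmf D \<Longrightarrow> h x \<in> {0..1}"
  shows "measure_pmf.prob (iid_tuple_pmf l D)
      {F. \<epsilon> \<le> \<bar>(\<Sum>i<l. h (F i)) / real l - measure_pmf.expectation D h\<bar>}
    \<le> 2 * exp (- 2 * real l * \<epsilon>\<^sup>2)"
proof -
  let ?M = "iid_tuple_pmf l D"
  have distr: "distr ?M borel (\<lambda>F. h (F i)) = distr (map_pmf h D) borel (\<lambda>x. x)" if "i < l" for i
    unfolding map_pmf_iid_tuple_component[OF that, of h D, symmetric]
    by (simp add: map_pmf_rep_eq distr_distr o_def)
  have E: "measure_pmf.expectation ?M (\<lambda>F. h (F 0)) = measure_pmf.expectation D h"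
    using arg_cong[OF map_pmf_iid_tuple_component[OF l, of h D],
        of "\<lambda>p. measure_pmf.expectation p (\<lambda>x. x)"] by simp
  have AE: "AE F in ?M. h (F 0) \<in> {0..1}"
  proof (rule AE_pmfI)
    fix F assume "F \<in> set_pmf ?M"
    then have "h (F 0) \<in> set_pmf (map_pmf (\<lambda>F. h (F 0)) ?M)" by auto
    then show "h (F 0) \<in> {0..1}"
      unfolding map_pmf_iid_tuple_component[OF l] using h by auto
  qed
  \<comment> \<open>The coordinates are independent for the discrete \<sigma>-algebra, from which
    every \<open>h\<close> is measurable, so independence passes to the
    \<open>h (F i)\<close>.\<close>
  have "prob_space.indep_vars ?M (\<lambda>_. count_space UNIV) (\<lambda>i F. F i) {..<l}"
    unfolding iid_tuple_pmf_def by (rule indep_vars_Pi_pmf) simp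
  then have indep: "prob_space.indep_vars ?M (\<lambda>_. borel) (\<lambda>i F. h (F i)) {..<l}"
    by (rule prob_space.indep_vars_compose2[OF measure_pmf.prob_space_axioms]) simp
  \<comment> \<open>Coordinate 0, which exists because \<open>l > 0\<close>, serves as the reference
    variable for the common distribution. The range [0, 1] has width 1, so no further factor enters
    the exponent.\<close>
  interpret Hoeffding_ineq_iid ?M "{..<l}" "\<lambda>i F. h (F i)" "\<lambda>F. h (F 0)" 0 1
      "measure_pmf.expectation ?M (\<lambda>F. h (F 0))"
    by unfold_locales (use indep distr l AE in \<open>auto\<close>)
  show ?thesis
    using Hoeffding_ineq_abs_ge'[OF \<epsilon>] l by (simp add: E lessThan_empty_iff)
qed

text \<open>Union bound over the bad events of the individual \<open>t\<close>, followed by passing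
  to the complement.\<close>

lemma iid_tuple_uniform_deviation:
  fixes h :: "'b \<Rightarrow> 'a \<Rightarrow> real"
  assumes T: "finite T" and l: "l > 0" and \<epsilon>: "\<epsilon> \<ge> 0"
    and h: "\<And>t x. t \<in> T \<Longrightarrow> x \<in> set_pmf D \<Longrightarrow> h t x \<in> {0..1}"
  shows "measure_pmf.prob (iid_tuple_pmf l D)
      {F. \<forall>t\<in>T. \<bar>(\<Sum>i<l. h t (F i)) / real l - measure_pmf.expectation D (h t)\<bar> < \<epsilon>}
    \<ge> 1 - real (card T) * (2 * exp (- 2 * real l * \<epsilon>\<^sup>2))"
proof -
  let ?M = "iid_tuple_pmf l D"
  let ?B = "\<lambda>t. {F. \<epsilon> \<le> \<bar>(\<Sum>i<l. h t (F i)) / real l - measure_pmf.expectation D (h t)\<bar>}"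
  have "measure_pmf.prob ?M (\<Union>t\<in>T. ?B t) \<le> (\<Sum>t\<in>T. measure_pmf.prob ?M (?B t))"
    using T by (intro measure_pmf.finite_measure_subadditive_finite) auto
  also have "\<dots> \<le> (\<Sum>t\<in>T. 2 * exp (- 2 * real l * \<epsilon>\<^sup>2))"
    using l \<epsilon> h by (intro sum_mono iid_tuple_Hoeffding)
  finally have "1 - real (card T) * (2 * exp (- 2 * real l * \<epsilon>\<^sup>2)) \<le> 1 - measure_pmf.prob ?M (\<Union>t\<in>T. ?B t)"
    by simp
  also have "\<dots> = measure_pmf.prob ?M (UNIV - (\<Union>t\<in>T. ?B t))"
    using measure_pmf.prob_compl[of "\<Union>t\<in>T. ?B t" ?M] by simp
  also have "UNIV - (\<Union>t\<in>T. ?B t) =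
      {F. \<forall>t\<in>T. \<bar>(\<Sum>i<l. h t (F i)) / real l - measure_pmf.expectation D (h t)\<bar> < \<epsilon>}"
    by (auto simp: not_le)
  finally show ?thesis .
qed

text \<open>The factor 3/2 in \<open>y\<close> makes the exponential at most the inverse cube of
  \<open>x\<close>. Rounding up costs at most 1, which is absorbed into a multiple of
  \<open>ln x / \<epsilon>\<^sup>2\<close>.\<close>

lemma sample_size_exists:
  fixes \<epsilon> x :: real
  assumes "0 < \<epsilon>" "\<epsilon> < 1" "2 \<le> x"
  obtains l :: nat where "l > 0" "real l \<le> 4 * ln x / \<epsilon>\<^sup>2" "exp (- 2 * real l * \<epsilon>\<^sup>2) \<le> 1 / x ^ 3"
proof
  define y where "y = 3 / 2 * ln x / \<epsilon>\<^sup>2"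
  define l where "l = nat \<lceil>y\<rceil>"
  \<comment> \<open>This amounts to exp (1/2) \<le> 2. Together with \<epsilon> < 1 it yields 1
    \<le> 2 ln x / \<epsilon>^2, and 3/2 + 2 \<le> 4 gives the final constant.\<close>
  have "1 / 2 \<le> ln (2::real)"
    using ln_ge_iff[of 2 "1/2"] exp_bound_half[of "1/2::real"] by auto
  moreover have "ln 2 \<le> ln x" using assms by simp
  ultimately have lnx: "1 / 2 \<le> ln x" by linarith
  have "\<epsilon>\<^sup>2 \<le> 1" using assms by (simp add: power_le_one)
  then have one: "1 \<le> 2 * ln x / \<epsilon>\<^sup>2"
    using assms lnx by (simp add: le_divide_eq_1)
  have "0 < y" using assms lnx by (simp add: y_def)
  then show "l > 0" by (simp add: l_def)
  have "real l \<le> y + 1" using \<open>0 < y\<close> by (simp add: l_def)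
  also have "\<dots> \<le> y + 2 * ln x / \<epsilon>\<^sup>2" using one by simp
  also have "\<dots> \<le> 4 * ln x / \<epsilon>\<^sup>2"
    using assms lnx by (simp add: y_def field_simps)
  finally show "real l \<le> 4 * ln x / \<epsilon>\<^sup>2" .
  have "y \<le> real l" by (simp add: l_def real_nat_ceiling_ge)
  then have "3 * ln x \<le> 2 * real l * \<epsilon>\<^sup>2"
    using assms by (simp add: y_def field_simps)
  then have "exp (- 2 * real l * \<epsilon>\<^sup>2) \<le> exp (- (3 * ln x))" by simp
  also have "\<dots> = 1 / x ^ 3"
    using assms exp_of_nat_mult[of 3 "ln x"] by (simp add: exp_minus inverse_eq_divide)
  finally show "exp (- 2 * real l * \<epsilon>\<^sup>2) \<le> 1 / x ^ 3" .
qed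

theorem theorem8:
  shows "\<exists>C::real. C > 0 \<and>
    (\<forall>(\<epsilon>::real) (\<delta>::real) (n::nat) (\<G>::nat pair_pre_digraph set)
       (D::nat pair_pre_digraph pmf) (S::nat pair_pre_digraph set).
       0 < \<epsilon> \<and> \<epsilon> < 1 \<and> 0 < \<delta> \<and> \<delta> < 1 \<and>
       iso_representatives n \<G> \<and> set_pmf D = \<G> \<and>
       S \<subseteq> \<G> \<and> finite S \<and> S \<noteq> {} \<and> real (card S) / \<delta> \<ge> 2 \<longrightarrow>
       (\<exists>l::nat. l > 0 \<and> real l \<le> C * ln (real (card S) / \<delta>) / \<epsilon>\<^sup>2 \<and>
          measure_pmf.prob (iid_tuple_pmf l D)
            {F. Max {\<bar>sampled_kernel l F G G' - expected_kernel D G G'\<bar> | G G'. G \<in> S \<and> G' \<in> S} < \<epsilon>}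
          \<ge> 1 - \<delta>))"
\<comment> \<open>The constant 4 is the one provided by \<open>sample_size_exists\<close>.\<close>
proof (rule exI[of _ 4], rule conjI, simp, intro allI impI, elim conjE)
  fix \<epsilon> \<delta> :: real and n :: nat and \<G> S :: "nat pair_pre_digraph set"
    and D :: "nat pair_pre_digraph pmf"
  assume \<epsilon>: "0 < \<epsilon>" "\<epsilon> < 1" and \<delta>: "0 < \<delta>" "\<delta> < 1"
    and \<G>: "iso_representatives n \<G>" "set_pmf D = \<G>" and S: "S \<subseteq> \<G>" "finite S" "S \<noteq> {}"
    and x: "2 \<le> real (card S) / \<delta>"
  define N where "N = real (card S)"
  obtain l :: nat where l: "l > 0" "real l \<le> 4 * ln (N / \<delta>) / \<epsilon>\<^sup>2"
    "exp (- 2 * real l * \<epsilon>\<^sup>2) \<le> 1 / (N / \<delta>) ^ 3"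
    using sample_size_exists[OF \<epsilon> x] unfolding N_def by blast
  define h where "h = (\<lambda>(G, G') F :: nat pair_pre_digraph.
    hom_density F (G :: nat pair_pre_digraph) * hom_density F (G' :: nat pair_pre_digraph))"
  have fin: "finite (pverts G)" if "G \<in> \<G>" for G
  proof -
    have "pair_graph G"
      using that \<G>(1) by (auto simp: iso_representatives_def simple_graph_def)
    then interpret pair_graph G .
    show ?thesis by simp
  qed
  \<comment> \<open>Sampled graphs and graphs in \<open>S\<close> all lie in \<open>\<G>\<close>,
    hence have finitely many vertices, and both density factors are in [0, 1].\<close>
  have h: "h t F \<in> {0..1}" if "t \<in> S \<times> S" "F \<in> set_pmf D" for t F
    using that \<G>(2) S(1) fin
    by (auto simp: h_def intro!: mult_nonneg_nonneg hom_density_nonneg mult_le_one hom_density_le_1)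
  have "N > 0" using S by (simp add: N_def card_gt_0_iff)
  have "real (card (S \<times> S)) * (2 * exp (- 2 * real l * \<epsilon>\<^sup>2)) \<le> N\<^sup>2 * (2 * (1 / (N / \<delta>) ^ 3))"
    using l(3) by (intro mult_mono) (auto simp: N_def card_cartesian_product power2_eq_square)
  also have "\<dots> = \<delta>\<^sup>2 * (2 / (N / \<delta>))"
    using \<open>N > 0\<close> \<delta> by (simp add: field_simps power2_eq_square power3_eq_cube)
  \<comment> \<open>Here the assumption |S|/\<delta> \<ge> 2 absorbs the factor 2 of the two-sided
    tail bound.\<close>
  also have "\<dots> \<le> \<delta>\<^sup>2 * 1"
    using x \<open>N > 0\<close> \<delta> by (intro mult_left_mono) (auto simp: N_def field_simps)
  also have "\<dots> \<le> \<delta>"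
    using \<delta> by (simp add: power2_eq_square mult_le_cancel_left1)
  finally have "1 - \<delta> \<le> 1 - real (card (S \<times> S)) * (2 * exp (- 2 * real l * \<epsilon>\<^sup>2))"
    by simp
  also have "\<dots> \<le> measure_pmf.prob (iid_tuple_pmf l D)
      {F. \<forall>t\<in>S \<times> S. \<bar>(\<Sum>i<l. h t (F i)) / real l - measure_pmf.expectation D (h t)\<bar> < \<epsilon>}"
    using S l \<epsilon> h by (intro iid_tuple_uniform_deviation) auto
  also have "{F. \<forall>t\<in>S \<times> S. \<bar>(\<Sum>i<l. h t (F i)) / real l - measure_pmf.expectation D (h t)\<bar> < \<epsilon>} =
      {F. Max {\<bar>sampled_kernel l F G G' - expected_kernel D G G'\<bar> | G G'. G \<in> S \<and> G' \<in> S} < \<epsilon>}"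
  proof (intro Collect_cong)
    fix F :: "nat \<Rightarrow> nat pair_pre_digraph"
    let ?d = "\<lambda>(G, G'). \<bar>sampled_kernel l F G G' - expected_kernel D G G'\<bar>"
    have "{\<bar>sampled_kernel l F G G' - expected_kernel D G G'\<bar> | G G'. G \<in> S \<and> G' \<in> S} = ?d ` (S \<times> S)"
      by auto
    \<comment> \<open>\<open>Max\<close> is meaningful here because \<open>S\<close> is finite and
      nonempty.\<close>
    moreover have "Max (?d ` (S \<times> S)) < \<epsilon> \<longleftrightarrow> (\<forall>t\<in>S \<times> S. ?d t < \<epsilon>)"
      using S by (subst Max_less_iff) auto
    \<comment> \<open>The two factors 1 / sqrt l of the embedding multiply to 1 / l, so the sampled
      kernel is the empirical mean of \<open>h t\<close>.\<close>
    moreover have "?d t = \<bar>(\<Sum>i<l. h t (F i)) / real l - measure_pmf.expectation D (h t)\<bar>" for t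
      by (cases t) (simp add: h_def sampled_kernel_eq expected_kernel_def)
    ultimately show "(\<forall>t\<in>S \<times> S. \<bar>(\<Sum>i<l. h t (F i)) / real l - measure_pmf.expectation D (h t)\<bar> < \<epsilon>) \<longleftrightarrow>
        Max {\<bar>sampled_kernel l F G G' - expected_kernel D G G'\<bar> | G G'. G \<in> S \<and> G' \<in> S} < \<epsilon>"
      by simp
  qed
  finally show "\<exists>l::nat. l > 0 \<and> real l \<le> 4 * ln (real (card S) / \<delta>) / \<epsilon>\<^sup>2 \<and>
      measure_pmf.prob (iid_tuple_pmf l D)
        {F. Max {\<bar>sampled_kernel l F G G' - expected_kernel D G G'\<bar> | G G'. G \<in> S \<and> G' \<in> S} < \<epsilon>}
      \<ge> 1 - \<delta>"
    using l unfolding N_def by blast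
qed

end
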